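(* Let $\alpha>0$, let $r^*:\mathcal{X}\times\mathcal{Y}\to\mathbb{R}$ be a reward function, and let $\pi^*$ be the optimal policy of the entropy-regularized (Maximum Entropy RL) problem for $r^*$ with coefficient $\alpha$. Suppose that preferences follow the Bradley--Terry model with reward $r^*$, i.e. for every prompt $x\in\mathcal{X}$ and all responses $y_1,y_2\in\mathcal{Y}$, $$p^*(y_1\succ y_2\mid x)=\frac{\exp(r^*(x,y_1))}{\exp(r^*(x,y_1))+\exp(r^*(x,y_2))}.$$ Then for every $x\in\mathcal{X}$ and all $y_1,y_2\in\mathcal{Y}$, $$p^*(y_1\succ y_2\mid x)=\sigma\bigl(\alpha\log\pi^*(y_1\mid x)-\alpha\log\pi^*(y_2\mid x)\bigr),$$ where $\sigma(t)=1/(1+e^{-t})$ is the logistic sigmoid.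
   Context: $\mathcal{X}$ is a set of prompts and $\mathcal{Y}$ is a nonempty countable (e.g. finite) set of responses. A policy (or model) $\pi$ assigns to each $x\in\mathcal{X}$ a probability distribution $\pi(\cdot\mid x)$ on $\mathcal{Y}$. Reward functions $r:\mathcal{X}\times\mathcal{Y}\to\mathbb{R}$ are assumed to satisfy $Z(x)=\sum_{y\in\mathcal{Y}}\exp(r(x,y)/\alpha)<\infty$ for every $x$ (automatic if $\mathcal{Y}$ is finite). Entropy-regularized (Maximum Entropy) RL problem for $r$ with coefficient $\alpha>0$: maximize over all policies $\pi$ the objective $$\mathbb{E}_{x\sim\mathcal{D},\,y\sim\pi(\cdot\mid x)}[r(x,y)]+\alpha\,\mathcal{H}[\pi(y\mid x)]=\mathbb{E}_{x\sim\mathcal{D}}\,\mathbb{E}_{y\sim\pi(\cdot\mid x)}\bigl[r(x,y)-\alpha\log\pi(y\mid x)\bigr],$$ where $\mathcal{D}$ is a distribution on prompts, $\mathcal{H}[\pi(y\mid x)]=-\mathbb{E}_{y\sim\pi(\cdot\mid x)}[\log\pi(y\mid x)]$, and $0\log 0=0$. The policy class is unrestricted (non-parametric), so the problem is solved separately for each prompt: the optimal policy is the policy $\pi$ such that for every $x\in\mathcal{X}$ the distribution $\pi(\cdot\mid x)$ maximizes $\mathbb{E}_{y\sim\pi(\cdot\mid x)}[r(x,y)-\alpha\log\pi(y\mid x)]$ over all probability distributions on $\mathcal{Y}$. *)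

theory Defs
  imports "HOL-Probability.Probability"
begin

text \<open>
  Prompts are the elements of a type \<open>'x\<close>, responses those of a (nonempty) countable type \<open>'y\<close>.
\<close>

type_synonym ('x, 'y) policy = "'x \<Rightarrow> 'y pmf"

definition sigmoid :: "real \<Rightarrow> real" where
  "sigmoid t = 1 / (1 + exp (- t))"

text \<open>Finiteness of the partition function \<open>Z(x)\<close> for every prompt.\<close>

definition reward_function :: "real \<Rightarrow> ('x \<Rightarrow> 'y::countable \<Rightarrow> real) \<Rightarrow> bool" where
  "reward_function \<alpha> r \<longleftrightarrow> (\<forall>x. (\<lambda>y. exp (r x y / \<alpha>)) summable_on UNIV)"

text \<open>
  Expectation with values in the extended reals, as positive part minus negative part
  (\<open>ennreal\<close> truncates negative numbers to 0). The Bochner integral is not suitable here: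
  for infinitely many responses the objective below can be \<open>-\<infinity>\<close>, where the Bochner integral
  returns 0. For a reward function with finite partition function the positive part of the
  objective has finite expectation, so the ill-defined case \<open>\<infinity> - \<infinity>\<close> does not occur.
\<close>

definition ext_expectation :: "'y pmf \<Rightarrow> ('y \<Rightarrow> real) \<Rightarrow> ereal" where
  "ext_expectation q f =
     enn2ereal (\<integral>\<^sup>+ y. ennreal (f y) \<partial>measure_pmf q) -
     enn2ereal (\<integral>\<^sup>+ y. ennreal (- f y) \<partial>measure_pmf q)"

text \<open>
  Responses of probability 0 do not contribute to the expectation, which is the convention
  \<open>0 log 0 = 0\<close>.
\<close>

definition maxent_objective ::
    "real \<Rightarrow> ('x \<Rightarrow> 'y::countable \<Rightarrow> real) \<Rightarrow> 'x \<Rightarrow> 'y pmf \<Rightarrow> ereal" where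
  "maxent_objective \<alpha> r x q = ext_expectation q (\<lambda>y. r x y - \<alpha> * ln (pmf q y))"

definition maxent_optimal_policy ::
    "real \<Rightarrow> ('x \<Rightarrow> 'y::countable \<Rightarrow> real) \<Rightarrow> ('x, 'y) policy \<Rightarrow> bool" where
  "maxent_optimal_policy \<alpha> r \<pi> \<longleftrightarrow>
     (\<forall>x. \<forall>q. maxent_objective \<alpha> r x q \<le> maxent_objective \<alpha> r x (\<pi> x))"

text \<open>Here \<open>p x y1 y2\<close> is the probability that \<open>y1\<close> is preferred to \<open>y2\<close> given the prompt \<open>x\<close>.\<close>

definition bradley_terry ::
    "('x \<Rightarrow> 'y \<Rightarrow> real) \<Rightarrow> ('x \<Rightarrow> 'y \<Rightarrow> 'y \<Rightarrow> real) \<Rightarrow> bool" where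
  "bradley_terry r p \<longleftrightarrow>
     (\<forall>x y1 y2. p x y1 y2 = exp (r x y1) / (exp (r x y1) + exp (r x y2)))"

end

theory Submission
  imports Defs
begin

text \<open>
  With \<open>g\<close> the Gibbs distribution \<open>exp (r / \<alpha>) / Z\<close>, the objective at \<open>q\<close> is
  \<open>\<alpha> * ln Z + \<alpha> * E\<^sub>q[ln (g / q)]\<close>. The first summand is its value at \<open>g\<close>, and the second one is
  at most \<open>\<alpha> * E\<^sub>q[g / q - 1] \<le> 0\<close>; equality forces \<open>g = q\<close> on the support of \<open>q\<close>, hence
  everywhere. So the optimal policy is \<open>g\<close>, and \<open>\<alpha> * ln (g y1) - \<alpha> * ln (g y2) = r y1 - r y2\<close>
  because the partition function cancels.
\<close>

lemma ext_expectation_cong: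
  assumes "\<And>y. y \<in> set_pmf q \<Longrightarrow> f y = h y"
  shows "ext_expectation q f = ext_expectation q h"
proof -
  have "(\<integral>\<^sup>+ y. ennreal (f y) \<partial>measure_pmf q) = (\<integral>\<^sup>+ y. ennreal (h y) \<partial>measure_pmf q)"
    "(\<integral>\<^sup>+ y. ennreal (- f y) \<partial>measure_pmf q) = (\<integral>\<^sup>+ y. ennreal (- h y) \<partial>measure_pmf q)"
    using assms by (auto intro!: nn_integral_cong_AE AE_pmfI)
  then show ?thesis
    by (simp add: ext_expectation_def)
qed

lemma ext_expectation_eq_integral:
  assumes "integrable (measure_pmf q) f"
  shows "ext_expectation q f = ereal (integral\<^sup>L (measure_pmf q) f)"
  using assms unfolding ext_expectation_def real_lebesgue_integral_def[OF assms] real_integrable_def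
  by (cases rule: ennreal2_cases[of "\<integral>\<^sup>+ y. ennreal (f y) \<partial>measure_pmf q"
        "\<integral>\<^sup>+ y. ennreal (- f y) \<partial>measure_pmf q"]) auto

text \<open>If the negative part had infinite expectation, then, the positive part being finite, the
  difference would be minus infinity, contradicting the real lower bound \<open>c\<close>.\<close>

lemma integrable_if_ext_expectation_ge:
  assumes "ereal c \<le> ext_expectation q f"
    and "(\<integral>\<^sup>+ y. ennreal (f y) \<partial>measure_pmf q) \<noteq> \<infinity>"
  shows "integrable (measure_pmf q) f"
proof -
  have "(\<integral>\<^sup>+ y. ennreal (- f y) \<partial>measure_pmf q) \<noteq> \<infinity>"
    using assms unfolding ext_expectation_def
    by (cases rule: ennreal2_cases[of "\<integral>\<^sup>+ y. ennreal (f y) \<partial>measure_pmf q"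
          "\<integral>\<^sup>+ y. ennreal (- f y) \<partial>measure_pmf q"]) auto
  then show ?thesis
    using assms(2) by (simp add: real_integrable_def)
qed

lemma nn_integral_likelihood_ratio_le_1:
  "(\<integral>\<^sup>+ y. ennreal (pmf g y / pmf q y) \<partial>measure_pmf q) \<le> 1"
proof -
  have "(\<integral>\<^sup>+ y. ennreal (pmf g y / pmf q y) \<partial>measure_pmf q)
      = (\<integral>\<^sup>+ y. ennreal (pmf q y) * ennreal (pmf g y / pmf q y) \<partial>count_space UNIV)"
    by (rule nn_integral_measure_pmf)
  also have "\<dots> \<le> (\<integral>\<^sup>+ y. ennreal (pmf g y) \<partial>count_space UNIV)"
    \<comment> \<open>On the support of \<open>q\<close> the two factors multiply to
      \<open>pmf g y\<close>; off it the summand is 0, so any mass of \<open>g\<close> there is lost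
      and only an inequality remains.\<close>
    by (intro nn_integral_mono) (auto simp: ennreal_mult[symmetric])
  also have "\<dots> = 1"
    by (simp add: nn_integral_pmf)
  finally show ?thesis .
qed

lemma integrable_likelihood_ratio:
  "integrable (measure_pmf q) (\<lambda>y. pmf g y / pmf q y)"
  using nn_integral_likelihood_ratio_le_1[of q g]
  by (auto simp: integrable_iff_bounded intro: le_less_trans)

lemma expectation_likelihood_ratio_le_1:
  "(\<integral>y. pmf g y / pmf q y \<partial>measure_pmf q) \<le> 1"
proof -
  have "ennreal (\<integral>y. pmf g y / pmf q y \<partial>measure_pmf q) \<le> ennreal 1"
    using nn_integral_likelihood_ratio_le_1[of q g]
    by (subst nn_integral_eq_integral[symmetric]) (auto intro: integrable_likelihood_ratio)
  then show ?thesis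
    by (subst (asm) ennreal_le_iff) auto
qed

text \<open>In the application \<open>c\<close> is \<open>\<alpha> * ln Z\<close> and
  \<open>ge\<close> says that \<open>q\<close> does at least as well as \<open>g\<close>.
  Integrability is not assumed: it has to be extracted from \<open>ge\<close> before expectations
  can be split linearly.\<close>

lemma gibbs_inequality_equality_case:
  fixes g q :: "'y pmf"
  assumes "\<alpha> > 0" and pos: "\<And>y. 0 < pmf g y"
    and ge: "ereal c \<le> ext_expectation q (\<lambda>y. c + \<alpha> * ln (pmf g y / pmf q y))"
  shows "q = g"
proof -
  define R where "R y = pmf g y / pmf q y" for y
  define f where "f y = c + \<alpha> * ln (R y)" for y
  have R_pos: "0 < R y" if "y \<in> set_pmf q" for y
    using that pos[of y] by (simp add: R_def pmf_positive)
  have R_int: "integrable (measure_pmf q) R"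
    unfolding R_def by (rule integrable_likelihood_ratio)
  \<comment> \<open>The positive part of \<open>f\<close> has finite expectation, since
    \<open>ln (R y) \<le> R y\<close> on the support and \<open>R\<close> is integrable.\<close>
  have "(\<integral>\<^sup>+ y. ennreal (f y) \<partial>measure_pmf q) \<le> (\<integral>\<^sup>+ y. ennreal (norm (c + \<alpha> * R y)) \<partial>measure_pmf q)"
  proof (intro nn_integral_mono_AE AE_pmfI ennreal_leI)
    fix y assume "y \<in> set_pmf q"
    then have "ln (R y) \<le> R y"
      using ln_le_minus_one[OF R_pos] by fastforce
    then have "f y \<le> c + \<alpha> * R y"
      using \<open>\<alpha> > 0\<close> by (simp add: f_def)
    then show "f y \<le> norm (c + \<alpha> * R y)"
      by simp
  qed
  also have "\<dots> < \<infinity>"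
  proof -
    have "integrable (measure_pmf q) (\<lambda>y. c + \<alpha> * R y)"
      using R_int by simp
    then show ?thesis
      by (simp add: integrable_iff_bounded)
  qed
  finally have f_int: "integrable (measure_pmf q) f"
    using ge by (intro integrable_if_ext_expectation_ge[of c]) (auto simp: f_def[abs_def] R_def)
  have f_ge: "c \<le> (\<integral>y. f y \<partial>measure_pmf q)"
    using ge ext_expectation_eq_integral[OF f_int] by (simp add: f_def[abs_def] R_def)
  \<comment> \<open>The slack in \<open>ln t \<le> t - 1\<close> at \<open>t = R y\<close>, scaled
    by \<open>\<alpha>\<close>. It is nonnegative on the support, yet its expectation turns out to
    be at most 0.\<close>
  define h where "h y = \<alpha> * (R y - 1) - (f y - c)" for y
  have h_nonneg: "0 \<le> h y" if "y \<in> set_pmf q" for y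
    using ln_le_minus_one[OF R_pos[OF that]] \<open>\<alpha> > 0\<close> by (simp add: h_def f_def)
  have h_int: "integrable (measure_pmf q) h"
    unfolding h_def using R_int f_int by simp
  have "(\<integral>y. h y \<partial>measure_pmf q)
      = \<alpha> * ((\<integral>y. R y \<partial>measure_pmf q) - 1) - ((\<integral>y. f y \<partial>measure_pmf q) - c)"
    unfolding h_def using R_int f_int by simp
  also have "\<dots> \<le> 0"
  proof -
    have "(\<integral>y. R y \<partial>measure_pmf q) \<le> 1"
      unfolding R_def by (rule expectation_likelihood_ratio_le_1)
    then have "\<alpha> * ((\<integral>y. R y \<partial>measure_pmf q) - 1) \<le> 0"
      using \<open>\<alpha> > 0\<close> by (simp add: mult_le_0_iff)
    with f_ge show ?thesis
      by linarith
  qed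
  finally have "(\<integral>y. h y \<partial>measure_pmf q) = 0"
    using h_nonneg by (intro antisym integral_nonneg_AE AE_pmfI) auto
  then have "AE y in measure_pmf q. h y = 0"
    using integral_nonneg_eq_0_iff_AE[OF h_int] h_nonneg by (auto intro: AE_pmfI)
  then have h_0: "h y = 0" if "y \<in> set_pmf q" for y
    using that by (simp add: AE_measure_pmf_iff)
  have eq: "pmf g y = pmf q y" if "y \<in> set_pmf q" for y
  proof -
    have "\<alpha> * (R y - 1) = \<alpha> * ln (R y)"
      using h_0[OF that] by (simp add: h_def f_def)
    then have "R y = 1"
      using ln_eq_minus_one[OF R_pos[OF that]] \<open>\<alpha> > 0\<close> by simp
    then show ?thesis
      by (simp add: R_def)
  qed
  show ?thesis
  proof (rule ccontr)
    assume "q \<noteq> g"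
    \<comment> \<open>Both mass functions sum to 1, so distinct ones cannot satisfy
      \<open>pmf q y \<le> pmf g y\<close> everywhere.\<close>
    then obtain y where y: "pmf g y < pmf q y"
      using pmf_neq_exists_less[of g q] by auto
    then have "y \<in> set_pmf q"
      using le_less_trans[OF pmf_nonneg y] by (simp add: set_pmf_iff)
    with y eq show False
      by simp
  qed
qed

lemma gibbs_pmf_exists:
  fixes w :: "'y \<Rightarrow> real"
  assumes summable: "w summable_on UNIV" and pos: "\<And>y. 0 < w y"
  obtains g :: "'y pmf" and Z :: real where "0 < Z" and "\<And>y. pmf g y = w y / Z"
proof -
  define Z where "Z = infsum w UNIV"
  \<comment> \<open>\<open>undefined\<close> serves as some element of the nonempty type; its
    positive weight bounds \<open>Z\<close> from below.\<close>
  have "w undefined \<le> Z"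
    using finite_sum_le_infsum[OF summable, of "{undefined}"] pos by (auto simp: Z_def less_imp_le)
  then have Z: "0 < Z"
    using pos[of undefined] by linarith
  \<comment> \<open>Passage from \<open>infsum\<close> to \<open>infsetsum\<close>, the sum that is
    linked to integrals over \<open>count_space\<close>.\<close>
  have w_abs: "Infinite_Set_Sum.abs_summable_on w UNIV"
    using summable
    by (rule summable_on_iff_abs_summable_on_real[THEN iffD1, THEN abs_summable_equivalent[THEN iffD1]])
  have "(\<integral>\<^sup>+ y. ennreal (w y / Z) \<partial>count_space UNIV)
      = (\<integral>\<^sup>+ y. ennreal (w y) \<partial>count_space UNIV) / ennreal Z"
    using Z pos by (simp add: divide_ennreal[symmetric] less_imp_le nn_integral_divide)
  also have "(\<integral>\<^sup>+ y. ennreal (w y) \<partial>count_space UNIV) = ennreal (infsetsum w UNIV)"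
    using w_abs pos by (intro nn_integral_conv_infsetsum) (auto simp: less_imp_le)
  also have "infsetsum w UNIV = Z"
    unfolding Z_def by (rule infsetsum_infsum[OF w_abs])
  also have "ennreal Z / ennreal Z = 1"
    using Z by (simp add: divide_ennreal)
  finally have "pmf (embed_pmf (\<lambda>y. w y / Z)) y = w y / Z" for y
    using Z pos by (intro pmf_embed_pmf) (auto simp: less_imp_le)
  with Z show thesis
    using that by blast
qed

lemma maxent_optimal_policy_eq_gibbs:
  fixes r :: "'x \<Rightarrow> 'y::countable \<Rightarrow> real"
  assumes "\<alpha> > 0" and "reward_function \<alpha> r" and opt: "maxent_optimal_policy \<alpha> r \<pi>"
  obtains Z where "0 < Z" and "\<And>y. pmf (\<pi> x) y = exp (r x y / \<alpha>) / Z"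
proof -
  have "(\<lambda>y. exp (r x y / \<alpha>)) summable_on UNIV"
    using assms(2) by (simp add: reward_function_def)
  then obtain g Z where Z: "0 < Z" and g: "\<And>y. pmf g y = exp (r x y / \<alpha>) / Z"
    by (rule gibbs_pmf_exists) auto
  have g_pos: "0 < pmf g y" for y
    using Z by (simp add: g)
  have r_eq: "r x y = \<alpha> * ln Z + \<alpha> * ln (pmf g y)" for y
    using Z \<open>\<alpha> > 0\<close> by (simp add: g ln_div algebra_simps)
  have objective: "maxent_objective \<alpha> r x q
      = ext_expectation q (\<lambda>y. \<alpha> * ln Z + \<alpha> * ln (pmf g y / pmf q y))" for q
    unfolding maxent_objective_def
  \<comment> \<open>The integrands need to agree only on the support of \<open>q\<close>, where
    \<open>ln\<close> of the quotient splits.\<close>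
  proof (rule ext_expectation_cong)
    fix y assume "y \<in> set_pmf q"
    then show "r x y - \<alpha> * ln (pmf q y) = \<alpha> * ln Z + \<alpha> * ln (pmf g y / pmf q y)"
      using g_pos[of y] pmf_positive[of y q] by (simp add: r_eq ln_div algebra_simps)
  qed
  \<comment> \<open>At \<open>q = g\<close> the ratio is 1 and its logarithm vanishes. Optimality is
    then applied with \<open>g\<close> as the competitor.\<close>
  have "maxent_objective \<alpha> r x g = ext_expectation g (\<lambda>y. \<alpha> * ln Z)"
    unfolding objective using g_pos by (intro ext_expectation_cong) (simp add: less_imp_neq[symmetric])
  also have "\<dots> = ereal (\<alpha> * ln Z)"
    by (simp add: ext_expectation_eq_integral)
  finally have "ereal (\<alpha> * ln Z) \<le> maxent_objective \<alpha> r x (\<pi> x)"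
    using opt by (metis maxent_optimal_policy_def)
  then have "\<pi> x = g"
    unfolding objective using gibbs_inequality_equality_case[OF \<open>\<alpha> > 0\<close> g_pos] by blast
  with Z g show thesis
    using that by blast
qed

theorem mainTheorem1:
  fixes \<alpha> :: real
    and r_star :: "'x \<Rightarrow> 'y::countable \<Rightarrow> real"
    and \<pi>_star :: "('x, 'y) policy"
    and p_star :: "'x \<Rightarrow> 'y \<Rightarrow> 'y \<Rightarrow> real"
  assumes "\<alpha> > 0"
    and "reward_function \<alpha> r_star"
    and "maxent_optimal_policy \<alpha> r_star \<pi>_star"
    and "bradley_terry r_star p_star"
  shows "\<forall>x y1 y2. p_star x y1 y2 =
           sigmoid (\<alpha> * ln (pmf (\<pi>_star x) y1) - \<alpha> * ln (pmf (\<pi>_star x) y2))"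
proof (intro allI)
  fix x y1 y2
  obtain Z where Z: "0 < Z" and gibbs: "\<And>y. pmf (\<pi>_star x) y = exp (r_star x y / \<alpha>) / Z"
    using maxent_optimal_policy_eq_gibbs[OF assms(1-3)] by blast
  have log: "\<alpha> * ln (pmf (\<pi>_star x) y) = r_star x y - \<alpha> * ln Z" for y
    using Z \<open>\<alpha> > 0\<close> by (simp add: gibbs ln_div algebra_simps)
  have "p_star x y1 y2 = exp (r_star x y1) / (exp (r_star x y1) + exp (r_star x y2))"
    using assms(4) by (simp add: bradley_terry_def)
  \<comment> \<open>Numerator and denominator are divided by
    \<open>exp (r_star x y1)\<close>.\<close>
  also have "\<dots> = sigmoid (r_star x y1 - r_star x y2)"
    by (simp add: sigmoid_def exp_diff divide_simps add_pos_pos less_imp_neq[symmetric])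
  finally show "p_star x y1 y2 =
      sigmoid (\<alpha> * ln (pmf (\<pi>_star x) y1) - \<alpha> * ln (pmf (\<pi>_star x) y2))"
    by (simp add: log)
qed

end
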